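(* Let $\beta=\binom n2$ and $m\ge\beta$, and let $G$ be an irreducible limited $m\times n$ configuration with $R$ displayed squares. Let $U$ be a set of $s$ degree-one rows (rows containing exactly one one-edge) of $G$. Let $h(U)$ be the number of holes (unoccupied cells) in these rows and $p(U)$ the number of two-edges whose two halves both lie in rows of $U$. Then $$R-ns+h(U)+p(U)\le z_2(m-s,n).$$
   Context: Consider a grid with $m$ rows and $n$ columns. Identify the cell $(i,j)$ (row $i$, column $j$) with the monomial $u_{ij}=x_iy_j$ in real variables $x_i,y_j$. A bilinear form is a real linear combination of the $u_{ij}$. If $P$ is a sum of squares of real bilinear forms, $\mathrm{SOS}(P)$ is the least number of squares in such a representation. A one-edge is a single cell; a two-edge is an unordered pair of two distinct cells, its halves (possibly in a common row or column). An augmented configuration $G$ consists of a set $E_1$ of one-edges and a set $E_2$ of two-edges; it is simple if distinct selected edges have disjoint supports (sets of cells). A cell is occupied if it lies in the support of a selected edge. Put $P_G=\sum_{(i,j)\in E_1}u_{ij}^2+\sum_{\{(i,j),(k,\ell)\}\in E_2}(u_{ij}+u_{k\ell})^2$ and $R(G)=|E_1|+|E_2|$ (the number of displayed squares). $G$ is irreducible if $\mathrm{SOS}(P_G)=R(G)$. $z(m,n)$ is the maximum number of edges of a $C_4$-free bipartite graph with parts $[m]$ (rows) and $[n]$ (columns). $G$ is limited if it is simple, $E_1$ is $C_4$-free as a bipartite graph, and $|E_1|=z(m,n)$. $z_2(m,n)$ is the maximum of $R(G)$ over irreducible limited $m\times n$ configurations. (For $m\ge\beta$ one has $z(m,n)=m+\beta$,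 and every $C_4$-free $E_1$ attaining this has exactly $\beta$ rows of degree two and $m-\beta$ rows of degree one, so $s\le m-\beta$.) *)

theory Defs
  imports Complex_Main "HOL-Library.Disjoint_Sets"
begin

type_synonym cell = "nat \<times> nat"

text \<open>Cells are pairs (row, column), both indices counted from 1.\<close>

definition grid :: "nat \<Rightarrow> nat \<Rightarrow> cell set" where
  "grid m n = {1..m} \<times> {1..n}"

text \<open>Polynomials in the real variables \<open>x\<^sub>i\<close>, \<open>y\<^sub>j\<close> are represented by the polynomial
  functions they induce; over the reals this representation is faithful.\<close>

type_synonym form = "(nat \<Rightarrow> real) \<Rightarrow> (nat \<Rightarrow> real) \<Rightarrow> real"

definition cell_monomial :: "cell \<Rightarrow> form" where
  "cell_monomial c x y = x (fst c) * y (snd c)"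

definition bilinear_form :: "nat \<Rightarrow> nat \<Rightarrow> form \<Rightarrow> bool" where
  "bilinear_form m n B \<longleftrightarrow> (\<exists>a :: cell \<Rightarrow> real. \<forall>x y. B x y = (\<Sum>c\<in>grid m n. a c * cell_monomial c x y))"

definition is_sum_of_squares :: "nat \<Rightarrow> nat \<Rightarrow> form \<Rightarrow> nat \<Rightarrow> bool" where
  "is_sum_of_squares m n P r \<longleftrightarrow>
     (\<exists>B :: nat \<Rightarrow> form. (\<forall>k<r. bilinear_form m n (B k)) \<and>
        (\<forall>x y. P x y = (\<Sum>k<r. (B k x y)\<^sup>2)))"

text \<open>Only meaningful if \<open>P\<close> is a sum of squares of bilinear forms.\<close>

definition SOS :: "nat \<Rightarrow> nat \<Rightarrow> form \<Rightarrow> nat" where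
  "SOS m n P = (LEAST r. is_sum_of_squares m n P r)"

record config =
  one_edges :: "cell set"
  two_edges :: "cell set set"

definition configuration :: "nat \<Rightarrow> nat \<Rightarrow> config \<Rightarrow> bool" where
  "configuration m n G \<longleftrightarrow>
     one_edges G \<subseteq> grid m n \<and> (\<forall>e\<in>two_edges G. e \<subseteq> grid m n \<and> card e = 2)"

text \<open>An edge is determined by its support: a singleton for a one-edge, a two-element
  set for a two-edge.\<close>

definition supports :: "config \<Rightarrow> cell set set" where
  "supports G = (\<lambda>c. {c}) ` one_edges G \<union> two_edges G"

definition simple_config :: "config \<Rightarrow> bool" where
  "simple_config G \<longleftrightarrow> disjoint (supports G)"

definition occupied :: "config \<Rightarrow> cell \<Rightarrow> bool" where
  "occupied G c \<longleftrightarrow> c \<in> \<Union> (supports G)"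

definition P_form :: "config \<Rightarrow> form" where
  "P_form G x y =
     (\<Sum>c\<in>one_edges G. (cell_monomial c x y)\<^sup>2) + (\<Sum>e\<in>two_edges G. (\<Sum>c\<in>e. cell_monomial c x y)\<^sup>2)"

definition num_squares :: "config \<Rightarrow> nat" where
  "num_squares G = card (one_edges G) + card (two_edges G)"

definition irreducible_config :: "nat \<Rightarrow> nat \<Rightarrow> config \<Rightarrow> bool" where
  "irreducible_config m n G \<longleftrightarrow> SOS m n (P_form G) = num_squares G"

text \<open>A set of cells is read as the edge set of a bipartite graph between rows and columns.\<close>

definition C4_free :: "cell set \<Rightarrow> bool" where
  "C4_free E \<longleftrightarrow> \<not> (\<exists>i i' j j'. i \<noteq> i' \<and> j \<noteq> j' \<and>
     (i, j) \<in> E \<and> (i, j') \<in> E \<and> (i', j) \<in> E \<and> (i', j') \<in> E)"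

definition zarankiewicz :: "nat \<Rightarrow> nat \<Rightarrow> nat" where
  "zarankiewicz m n = Max {card E | E. E \<subseteq> grid m n \<and> C4_free E}"

definition limited :: "nat \<Rightarrow> nat \<Rightarrow> config \<Rightarrow> bool" where
  "limited m n G \<longleftrightarrow> configuration m n G \<and> simple_config G \<and>
     C4_free (one_edges G) \<and> card (one_edges G) = zarankiewicz m n"

definition z2 :: "nat \<Rightarrow> nat \<Rightarrow> nat" where
  "z2 m n = Max {num_squares G | G. limited m n G \<and> irreducible_config m n G}"

definition degree_one_rows :: "nat \<Rightarrow> config \<Rightarrow> nat set" where
  "degree_one_rows m G = {i \<in> {1..m}. card {j. (i, j) \<in> one_edges G} = 1}"

definition holes :: "nat \<Rightarrow> config \<Rightarrow> nat set \<Rightarrow> nat" where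
  "holes n G U = card {c \<in> U \<times> {1..n}. \<not> occupied G c}"

definition inner_two_edges :: "config \<Rightarrow> nat set \<Rightarrow> nat" where
  "inner_two_edges G U = card {e \<in> two_edges G. \<forall>c\<in>e. fst c \<in> U}"

end

(* Deleting the rows of U deletes exactly the squares whose support meets these rows.  Every row
   of U contains one one-edge, so counting the n * s cells of these rows shows that
   n * s - h(U) - p(U) squares are deleted.  A shorter representation of the remaining form would
   give one of P_G, so the remaining configuration is irreducible.  Let beta = n choose 2.  Counting
   the pairs of columns joined by a row gives z(m', n) <= m' + beta for every m', with equality if
   m' >= beta and n >= 1; so the (m + beta) - s remaining one-edges are at least z(m - s, n) many,
   and the remaining configuration is limited. *)

theory Submission
  imports Defs
begin

lemma finite_grid [simp]: "finite (grid m n)"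
  by (simp add: grid_def)

subsection \<open>Zarankiewicz numbers\<close>

text \<open>A row of degree d joins d choose 2 pairs of columns, and d exceeds this number by at
  most 1. In a \<open>C4_free\<close> graph no pair of columns is joined by two rows, so all rows
  together join at most n choose 2 pairs.\<close>

lemma card_C4_free_le:
  assumes E: "E \<subseteq> grid m n" and C4: "C4_free E"
  shows "card E \<le> m + (n choose 2)"
proof -
  define N where "N i = {j. (i, j) \<in> E}" for i
  define Q where "Q i = {A. A \<subseteq> N i \<and> card A = 2}" for i
  have N_sub: "N i \<subseteq> {1..n}" for i
    using E by (auto simp: N_def grid_def)
  have fin_N: "finite (N i)" for i
    using N_sub finite_subset by blast
  have "E = Sigma {1..m} N"
    using E by (auto simp: N_def grid_def)
  then have "card E = (\<Sum>i=1..m. card (N i))"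
    using fin_N by simp
  also have "\<dots> \<le> (\<Sum>i=1..m. 1 + card (Q i))"
  proof (rule sum_mono)
    fix i
    \<comment> \<open>Pascal's rule for d = k + 1 turns the right side into 1 + k + (k choose
      2).\<close>
    have "d \<le> 1 + (d choose 2)" for d
      by (cases d) (simp_all add: numeral_2_eq_2)
    then show "card (N i) \<le> 1 + card (Q i)"
      unfolding Q_def n_subsets[OF fin_N] .
  qed
  also have "\<dots> = m + (\<Sum>i=1..m. card (Q i))"
    by (subst sum.distrib) simp
  also have "(\<Sum>i=1..m. card (Q i)) = card (\<Union>i\<in>{1..m}. Q i)"
  proof (rule card_UN_disjoint[symmetric])
    show "\<forall>i\<in>{1..m}. finite (Q i)"
      using fin_N by (auto simp: Q_def)
    show "\<forall>i\<in>{1..m}. \<forall>i'\<in>{1..m}. i \<noteq> i' \<longrightarrow> Q i \<inter> Q i' = {}"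
    proof (intro ballI impI)
      fix i i' :: nat assume "i \<noteq> i'"
      show "Q i \<inter> Q i' = {}"
      proof (rule ccontr)
        assume "Q i \<inter> Q i' \<noteq> {}"
        then obtain A where "A \<subseteq> N i" "A \<subseteq> N i'" "card A = 2"
          by (auto simp: Q_def)
        moreover then obtain j j' where "A = {j, j'}" "j \<noteq> j'"
          by (meson card_2_iff)
        ultimately have "(i, j) \<in> E" "(i, j') \<in> E" "(i', j) \<in> E" "(i', j') \<in> E"
          by (simp_all add: N_def)
        with C4 \<open>i \<noteq> i'\<close> \<open>j \<noteq> j'\<close> show False
          unfolding C4_free_def by metis
      qed
    qed
  qed simp
  also have "\<dots> \<le> card {A. A \<subseteq> {1..n} \<and> card A = 2}"
  proof (rule card_mono)
    show "(\<Union>i\<in>{1..m}. Q i) \<subseteq> {A. A \<subseteq> {1..n} \<and> card A = 2}"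
      unfolding Q_def using N_sub by blast
  qed simp
  also have "\<dots> = n choose 2"
    by (simp add: n_subsets)
  finally show ?thesis by simp
qed

text \<open>Extremal graph: the first n choose 2 rows are joined to the distinct pairs of columns,
  one pair each, and every other row to column 1 only, which exists because n \<ge> 1.\<close>

lemma ex_C4_free_card:
  assumes "n \<ge> 1" and "m \<ge> n choose 2"
  shows "\<exists>E \<subseteq> grid m n. C4_free E \<and> card E = m + (n choose 2)"
proof -
  define b where "b = n choose 2"
  have "card {1..b} = card {A. A \<subseteq> {1..n} \<and> card A = 2}"
    by (simp add: n_subsets b_def)
  then obtain q where q: "bij_betw q {1..b} {A. A \<subseteq> {1..n} \<and> card A = 2}"
    using finite_same_card_bij[of "{1..b}" "{A. A \<subseteq> {1..n} \<and> card A = 2}"] by auto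
  define N where "N i = (if i \<le> b then q i else {1})" for i
  have q_in: "q i \<subseteq> {1..n} \<and> card (q i) = 2" if "i \<in> {1..b}" for i
    using bij_betwE[OF q] that by auto
  have N_sub: "N i \<subseteq> {1..n}" if "i \<in> {1..m}" for i
    using q_in[of i] that assms(1) by (auto simp: N_def)
  then have fin_N: "finite (N i)" if "i \<in> {1..m}" for i
    using that finite_subset by blast
  let ?E = "Sigma {1..m} N"
  have "card ?E = (\<Sum>i=1..m. card (N i))"
    using fin_N by simp
  also have "\<dots> = (\<Sum>i=1..m. 1 + (if i \<le> b then 1 else 0))"
    by (rule sum.cong) (use q_in in \<open>auto simp: N_def\<close>)
  also have "\<dots> = m + card ({1..m} \<inter> {i. i \<le> b})"
    by (subst sum.distrib) (simp add: sum.If_cases)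
  also have "{1..m} \<inter> {i. i \<le> b} = {1..b}"
    using assms(2) by (auto simp: b_def)
  finally have "card ?E = m + b" by simp
  moreover have "C4_free ?E"
    unfolding C4_free_def
  proof (intro notI, elim exE conjE)
    fix i i' j j' assume *: "i \<noteq> i'" "j \<noteq> j'" "(i, j) \<in> ?E" "(i, j') \<in> ?E"
      "(i', j) \<in> ?E" "(i', j') \<in> ?E"
    \<comment> \<open>Two distinct columns in a row rule out the rows joined to column 1 only, so
      the row carries exactly the pair \<open>{j, j'}\<close>; injectivity of \<open>q\<close> then
      leaves only one such row.\<close>
    have row: "k \<in> {1..b} \<and> q k = {j, j'}" if "(k, j) \<in> ?E" "(k, j') \<in> ?E" for k
    proof -
      have k: "k \<in> {1..b}"
        using that \<open>j \<noteq> j'\<close> by (auto simp: N_def split: if_splits)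
      then have "{j, j'} \<subseteq> q k"
        using that by (auto simp: N_def)
      moreover have "finite (q k)" "card (q k) = card {j, j'}"
        using q_in[OF k] \<open>j \<noteq> j'\<close> card_ge_0_finite[of "q k"] by auto
      ultimately have "{j, j'} = q k"
        by (intro card_subset_eq) auto
      with k show ?thesis by simp
    qed
    then show False
      using * bij_betw_imp_inj_on[OF q] by (metis inj_onD)
  qed
  moreover have "?E \<subseteq> grid m n"
    unfolding grid_def using N_sub by blast
  ultimately show ?thesis
    by (auto simp: b_def)
qed

lemma finite_C4_free_cards: "finite {card E | E. E \<subseteq> grid m n \<and> C4_free E}"
  by (rule finite_subset[of _ "card ` Pow (grid m n)"]) auto

lemma card_le_zarankiewicz: "E \<subseteq> grid m n \<Longrightarrow> C4_free E \<Longrightarrow> card E \<le> zarankiewicz m n"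
  unfolding zarankiewicz_def by (rule Max_ge[OF finite_C4_free_cards]) auto

lemma zarankiewicz_le: "zarankiewicz m n \<le> m + (n choose 2)"
proof -
  have "C4_free {}"
    by (simp add: C4_free_def)
  then have "{card E | E. E \<subseteq> grid m n \<and> C4_free E} \<noteq> {}"
    by blast
  then show ?thesis
    unfolding zarankiewicz_def using card_C4_free_le
    by (auto simp: Max_le_iff[OF finite_C4_free_cards])
qed

lemma zarankiewicz_ge:
  assumes "n \<ge> 1" and "m \<ge> n choose 2"
  shows "zarankiewicz m n \<ge> m + (n choose 2)"
  using ex_C4_free_card[OF assms] card_le_zarankiewicz by metis

subsection \<open>Sums of squares of bilinear forms\<close>

text \<open>Frees representations from the indexing by an initial segment of the naturals, so that
  edges themselves can serve as indices.\<close>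

lemma is_sum_of_squares_sum:
  assumes "finite I" and B: "\<And>i. i \<in> I \<Longrightarrow> bilinear_form m n (B i)"
  shows "is_sum_of_squares m n (\<lambda>x y. \<Sum>i\<in>I. (B i x y)\<^sup>2) (card I)"
proof -
  obtain h where h: "bij_betw h {..<card I} I"
    using assms(1) finite_same_card_bij[of "{..<card I}" I] by auto
  show ?thesis
    unfolding is_sum_of_squares_def
  proof (intro exI[of _ "\<lambda>k. B (h k)"] conjI allI impI)
    show "bilinear_form m n (B (h k))" if "k < card I" for k
      using B bij_betwE[OF h] that by auto
    show "(\<Sum>i\<in>I. (B i x y)\<^sup>2) = (\<Sum>k<card I. (B (h k) x y)\<^sup>2)" for x y
      by (rule sum.reindex_bij_betw[OF h, symmetric])
  qed
qed

lemma is_sum_of_squares_add: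
  assumes "is_sum_of_squares m n P r" and "is_sum_of_squares m n Q t"
  shows "is_sum_of_squares m n (\<lambda>x y. P x y + Q x y) (r + t)"
proof -
  from assms obtain B C where
    B: "\<And>k. k < r \<Longrightarrow> bilinear_form m n (B k)" "\<And>x y. P x y = (\<Sum>k<r. (B k x y)\<^sup>2)" and
    C: "\<And>k. k < t \<Longrightarrow> bilinear_form m n (C k)" "\<And>x y. Q x y = (\<Sum>k<t. (C k x y)\<^sup>2)"
    unfolding is_sum_of_squares_def by metis
  \<comment> \<open>Indexing by a disjoint union avoids shifting the indices of the second
    family.\<close>
  let ?D = "\<lambda>s. case s of Inl k \<Rightarrow> B k | Inr k \<Rightarrow> C k"
  have "is_sum_of_squares m n (\<lambda>x y. \<Sum>s\<in>{..<r} <+> {..<t}. (?D s x y)\<^sup>2) (card ({..<r} <+> {..<t}))"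
    by (rule is_sum_of_squares_sum) (auto simp: B C)
  then show ?thesis
    by (simp add: sum.Plus card_Plus B C)
qed

text \<open>Substituting \<open>x \<circ> f\<close> turns the monomial of cell (i, j) into that of
  (f i, j), so it suffices to carry the coefficients along the injective cell map. This moves forms
  from the smaller grid to the larger one.\<close>

lemma bilinear_form_rename_rows:
  assumes "bilinear_form m n B" and f: "inj_on f {1..m}" "f ` {1..m} \<subseteq> {1..m'}"
  shows "bilinear_form m' n (\<lambda>x y. B (x \<circ> f) y)"
proof -
  let ?h = "map_prod f (id :: nat \<Rightarrow> nat)"
  from assms(1) obtain a where a: "\<And>x y. B x y = (\<Sum>c\<in>grid m n. a c * cell_monomial c x y)"
    unfolding bilinear_form_def by metis
  have inj: "inj_on ?h (grid m n)"
    unfolding grid_def by (rule map_prod_inj_on[OF f(1)]) simp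
  have sub: "?h ` grid m n \<subseteq> grid m' n"
    using f(2) by (auto simp: grid_def image_subset_iff)
  \<comment> \<open>Cells outside the image get coefficient 0 and so do not contribute to the
    sum.\<close>
  let ?a = "\<lambda>c. if c \<in> ?h ` grid m n then a (inv_into (grid m n) ?h c) else 0"
  have "B (x \<circ> f) y = (\<Sum>c\<in>grid m' n. ?a c * cell_monomial c x y)" for x y
  proof -
    have "B (x \<circ> f) y = (\<Sum>c\<in>grid m n. ?a (?h c) * cell_monomial (?h c) x y)"
      unfolding a by (rule sum.cong) (auto simp: inv_into_f_f[OF inj] cell_monomial_def)
    also have "\<dots> = (\<Sum>c\<in>?h ` grid m n. ?a c * cell_monomial c x y)"
      by (simp only: sum.reindex[OF inj] o_def)
    also have "\<dots> = (\<Sum>c\<in>grid m' n. ?a c * cell_monomial c x y)"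
      by (rule sum.mono_neutral_left) (use sub in auto)
    finally show ?thesis .
  qed
  then show ?thesis
    unfolding bilinear_form_def by (intro exI[of _ ?a]) blast
qed

lemma is_sum_of_squares_rename_rows:
  assumes "is_sum_of_squares m n P r" and "inj_on f {1..m}" "f ` {1..m} \<subseteq> {1..m'}"
  shows "is_sum_of_squares m' n (\<lambda>x y. P (x \<circ> f) y) r"
proof -
  from assms(1) obtain B where
    "\<And>k. k < r \<Longrightarrow> bilinear_form m n (B k)" "\<And>x y. P x y = (\<Sum>k<r. (B k x y)\<^sup>2)"
    unfolding is_sum_of_squares_def by metis
  then show ?thesis
    unfolding is_sum_of_squares_def using bilinear_form_rename_rows[OF _ assms(2,3)]
    by (intro exI[of _ "\<lambda>k x y. B k (x \<circ> f) y"]) auto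
qed

section \<open>The displayed squares as a representation, and irreducibility as minimality\<close>

lemma bilinear_form_sum_cells:
  assumes "e \<subseteq> grid m n"
  shows "bilinear_form m n (\<lambda>x y. \<Sum>c\<in>e. cell_monomial c x y)"
proof -
  have "(\<Sum>c\<in>e. cell_monomial c x y)
      = (\<Sum>c\<in>grid m n. (if c \<in> e then 1 else 0) * cell_monomial c x y)" for x y
    by (rule sum.mono_neutral_cong_left) (use assms in auto)
  then show ?thesis
    unfolding bilinear_form_def by (intro exI[of _ "\<lambda>c. if c \<in> e then 1 else 0"]) blast
qed

lemma configuration_finite:
  assumes "configuration m n G"
  shows "finite (one_edges G)" "finite (two_edges G)"
proof -
  show "finite (one_edges G)"
    using assms finite_subset[OF _ finite_grid] by (auto simp: configuration_def)
  have "two_edges G \<subseteq> Pow (grid m n)"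
    using assms by (auto simp: configuration_def)
  then show "finite (two_edges G)"
    by (rule finite_subset) simp
qed

lemma is_sum_of_squares_P_form:
  assumes "configuration m n G"
  shows "is_sum_of_squares m n (P_form G) (num_squares G)"
proof -
  \<comment> \<open>A one-edge is written as a sum over a singleton so that one-edges and two-edges
    are treated by the same lemma.\<close>
  have "is_sum_of_squares m n (\<lambda>x y. \<Sum>c\<in>one_edges G. (\<Sum>c'\<in>{c}. cell_monomial c' x y)\<^sup>2)
      (card (one_edges G))"
    using assms configuration_finite[OF assms]
    by (intro is_sum_of_squares_sum bilinear_form_sum_cells) (auto simp: configuration_def)
  moreover have "is_sum_of_squares m n (\<lambda>x y. \<Sum>e\<in>two_edges G. (\<Sum>c\<in>e. cell_monomial c x y)\<^sup>2)
      (card (two_edges G))"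
    using assms configuration_finite[OF assms]
    by (intro is_sum_of_squares_sum bilinear_form_sum_cells) (auto simp: configuration_def)
  ultimately show ?thesis
    using is_sum_of_squares_add by (fastforce simp: P_form_def[abs_def] num_squares_def)
qed

text \<open>The displayed squares already form a representation with \<open>num_squares G\<close>
  squares, so this number equals the least one exactly when no representation is shorter.\<close>

lemma irreducible_config_iff:
  assumes "configuration m n G"
  shows "irreducible_config m n G \<longleftrightarrow> (\<forall>r. is_sum_of_squares m n (P_form G) r \<longrightarrow> num_squares G \<le> r)"
proof
  assume "irreducible_config m n G"
  then show "\<forall>r. is_sum_of_squares m n (P_form G) r \<longrightarrow> num_squares G \<le> r"
    unfolding irreducible_config_def SOS_def by (auto dest: Least_le)
next
  assume "\<forall>r. is_sum_of_squares m n (P_form G) r \<longrightarrow> num_squares G \<le> r"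
  then show "irreducible_config m n G"
    unfolding irreducible_config_def SOS_def
    using is_sum_of_squares_P_form[OF assms] by (intro Least_equality) auto
qed

subsection \<open>Restriction to a set of rows\<close>

text \<open>The function \<open>f\<close> embeds the rows of the smaller grid, so that the smaller
  configuration is numbered from 1 again.\<close>

definition restrict_rows :: "nat \<Rightarrow> nat \<Rightarrow> (nat \<Rightarrow> nat) \<Rightarrow> config \<Rightarrow> config" where
  "restrict_rows m n f G =
     \<lparr>one_edges = {c \<in> grid m n. map_prod f id c \<in> one_edges G},
      two_edges = {e \<in> Pow (grid m n). map_prod f id ` e \<in> two_edges G}\<rparr>"

text \<open>Setting for deleting rows: \<open>W\<close> is the set of kept rows, and
  \<open>f\<close> numbers them by 1, ..., m'. Below, \<open>K1\<close> and \<open>K2\<close>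
  collect the surviving edges of \<open>G\<close>; a two-edge with even one half in a deleted row is
  lost.\<close>

locale row_embedding =
  fixes m m' n :: nat and f :: "nat \<Rightarrow> nat" and W :: "nat set" and G :: config
  assumes bij: "bij_betw f {1..m'} W" and W: "W \<subseteq> {1..m}" and conf: "configuration m n G"
begin

abbreviation "h \<equiv> map_prod f (id :: nat \<Rightarrow> nat)"
abbreviation "H \<equiv> restrict_rows m' n f G"
abbreviation "K1 \<equiv> {c \<in> one_edges G. fst c \<in> W}"
abbreviation "K2 \<equiv> {e \<in> two_edges G. \<forall>c\<in>e. fst c \<in> W}"

lemma bij_cells: "bij_betw h (grid m' n) (W \<times> {1..n})"
  unfolding grid_def by (rule bij_betw_map_prod[OF bij]) simp

lemma inj_cells: "inj_on h (grid m' n)"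
  using bij_cells by (rule bij_betw_imp_inj_on)

lemma inj_subset: "e \<subseteq> grid m' n \<Longrightarrow> inj_on h e"
  using inj_cells inj_on_subset by blast

text \<open>The cells of \<open>K1\<close> lie in \<open>W \<times> {1..n}\<close>, which is the
  image of the smaller grid under \<open>h\<close>, so each has a preimage there.\<close>

lemma bij_one_edges: "bij_betw h (one_edges H) K1"
  unfolding bij_betw_def
proof
  show "inj_on h (one_edges H)"
    by (rule inj_subset) (auto simp: restrict_rows_def)
  have "c \<in> h ` one_edges H" if "c \<in> K1" for c
  proof -
    from that conf have "c \<in> W \<times> {1..n}"
      by (auto simp: configuration_def grid_def)
    then have "c \<in> h ` grid m' n"
      using bij_cells by (simp only: bij_betw_def)
    then obtain d where d: "c = h d" "d \<in> grid m' n"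
      by (rule imageE)
    from that have "c \<in> one_edges G" by blast
    with d have "d \<in> one_edges H"
      by (simp add: restrict_rows_def)
    with d(1) show ?thesis by (rule image_eqI)
  qed
  moreover have "h c \<in> K1" if "c \<in> one_edges H" for c
  proof -
    have "c \<in> grid m' n" "h c \<in> one_edges G"
      using that by (simp_all add: restrict_rows_def)
    moreover have "h c \<in> W \<times> {1..n}"
      using bij_betwE[OF bij_cells] \<open>c \<in> grid m' n\<close> by blast
    ultimately show ?thesis
      by (simp add: mem_Times_iff del: fst_map_prod)
  qed
  ultimately show "h ` one_edges H = K1"
    by (intro equalityI image_subsetI subsetI) simp_all
qed

text \<open>The same identification one level up: injectivity of \<open>h\<close> on the grid passes
  to images of its subsets.\<close>

lemma bij_two_edges: "bij_betw ((`) h) (two_edges H) K2"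
  unfolding bij_betw_def
proof
  show "inj_on ((`) h) (two_edges H)"
    using inj_on_image_Pow[OF inj_cells] by (rule inj_on_subset) (auto simp: restrict_rows_def)
  have "e \<in> (`) h ` two_edges H" if "e \<in> K2" for e
  proof -
    from that conf have "e \<subseteq> W \<times> {1..n}"
      by (fastforce simp: configuration_def grid_def)
    then have "e \<in> Pow (h ` grid m' n)"
      using bij_cells by (auto simp: bij_betw_def)
    then obtain d where "d \<subseteq> grid m' n" "e = h ` d"
      by (auto simp: subset_image_iff)
    with that show ?thesis
      by (auto simp: restrict_rows_def)
  qed
  moreover have "h ` e \<in> K2" if "e \<in> two_edges H" for e
  proof -
    have "e \<subseteq> grid m' n" "h ` e \<in> two_edges G"
      using that by (auto simp: restrict_rows_def)
    moreover have "h ` e \<subseteq> W \<times> {1..n}"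
      using \<open>e \<subseteq> grid m' n\<close> bij_cells by (auto simp: bij_betw_def)
    ultimately show ?thesis by auto
  qed
  ultimately show "(`) h ` two_edges H = K2" by blast
qed

lemma num_squares_restrict: "num_squares H = card K1 + card K2"
  using bij_betw_same_card[OF bij_one_edges] bij_betw_same_card[OF bij_two_edges]
  by (simp add: num_squares_def)

lemma configuration_restrict: "configuration m' n H"
proof -
  have "card e = 2" if "e \<in> two_edges H" for e
  proof -
    have "e \<subseteq> grid m' n" "card (h ` e) = 2"
      using that conf by (auto simp: restrict_rows_def configuration_def)
    then show ?thesis
      using card_image[OF inj_subset] by metis
  qed
  then show ?thesis
    by (auto simp: configuration_def restrict_rows_def)
qed

text \<open>Distinct supports of \<open>H\<close> have distinct images because \<open>h\<close> is
  injective on the grid; these images are disjoint in \<open>G\<close>, and disjointness pulls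
  back.\<close>

lemma simple_config_restrict:
  assumes "simple_config G"
  shows "simple_config H"
  unfolding simple_config_def
proof (rule disjointI)
  fix d e assume de: "d \<in> supports H" "e \<in> supports H" "d \<noteq> e"
  have *: "a \<subseteq> grid m' n \<and> h ` a \<in> supports G" if "a \<in> supports H" for a
    using that by (auto simp: supports_def restrict_rows_def)
  have "h ` d \<noteq> h ` e"
    using * de inj_on_image_eq_iff[OF inj_cells] by metis
  then have "h ` d \<inter> h ` e = {}"
    using assms * de unfolding simple_config_def by (meson disjointD)
  then show "d \<inter> e = {}" by blast
qed

lemma C4_free_restrict:
  assumes "C4_free (one_edges G)"
  shows "C4_free (one_edges H)"
  unfolding C4_free_def
proof (intro notI, elim exE conjE)
  fix i i' j j' assume *: "i \<noteq> i'" "j \<noteq> j'" "(i, j) \<in> one_edges H" "(i, j') \<in> one_edges H"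
    "(i', j) \<in> one_edges H" "(i', j') \<in> one_edges H"
  then have "f i \<noteq> f i'"
    using bij_betw_imp_inj_on[OF bij]
    by (auto simp: restrict_rows_def grid_def dest: inj_onD)
  with * assms show False
    unfolding C4_free_def restrict_rows_def by (simp, blast)
qed

text \<open>After renaming the row variables, the form of \<open>H\<close> is the part of the form
  of \<open>G\<close> made of the surviving squares; the sums are reindexed along the two
  bijections.\<close>

lemma P_form_restrict: "P_form H (x \<circ> f) y = P_form \<lparr>one_edges = K1, two_edges = K2\<rparr> x y"
proof -
  have mono: "cell_monomial c (x \<circ> f) y = cell_monomial (h c) x y" for c
    by (simp add: cell_monomial_def)
  have "(\<Sum>c\<in>e. cell_monomial (h c) x y) = (\<Sum>c\<in>h ` e. cell_monomial c x y)"
    if "e \<in> two_edges H" for e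
  proof -
    have "inj_on h e"
      using that by (intro inj_subset) (auto simp: restrict_rows_def)
    then show ?thesis by (simp add: sum.reindex)
  qed
  then have "(\<Sum>e\<in>two_edges H. (\<Sum>c\<in>e. cell_monomial c (x \<circ> f) y)\<^sup>2)
      = (\<Sum>e\<in>two_edges H. (\<Sum>c\<in>h ` e. cell_monomial c x y)\<^sup>2)"
    by (simp add: mono)
  also have "\<dots> = (\<Sum>e\<in>K2. (\<Sum>c\<in>e. cell_monomial c x y)\<^sup>2)"
    by (rule sum.reindex_bij_betw[OF bij_two_edges])
  moreover have "(\<Sum>c\<in>one_edges H. (cell_monomial c (x \<circ> f) y)\<^sup>2) = (\<Sum>c\<in>K1. (cell_monomial c x y)\<^sup>2)"
    unfolding mono by (rule sum.reindex_bij_betw[OF bij_one_edges])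
  ultimately show ?thesis
    by (simp add: P_form_def)
qed

text \<open>A representation of the form of \<open>H\<close> with r squares, moved to the large grid
  and completed by the deleted squares, represents the form of \<open>G\<close>. Minimality for
  \<open>G\<close> then bounds r from below.\<close>

lemma irreducible_config_restrict:
  assumes "irreducible_config m n G"
  shows "irreducible_config m' n H"
  unfolding irreducible_config_iff[OF configuration_restrict]
proof (intro allI impI)
  fix r assume r: "is_sum_of_squares m' n (P_form H) r"
  note fin = configuration_finite[OF conf]
  \<comment> \<open>\<open>?K\<close> holds the surviving squares and \<open>?L\<close> the deleted
    ones.\<close>
  let ?K = "\<lparr>one_edges = K1, two_edges = K2\<rparr>"
  let ?L = "\<lparr>one_edges = one_edges G - K1, two_edges = two_edges G - K2\<rparr>"
  have "is_sum_of_squares m n (\<lambda>x y. P_form H (x \<circ> f) y) r"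
    by (rule is_sum_of_squares_rename_rows[OF r]) (use bij W in \<open>auto simp: bij_betw_def\<close>)
  then have "is_sum_of_squares m n (P_form ?K) r"
    unfolding P_form_restrict .
  moreover have "is_sum_of_squares m n (P_form ?L) (num_squares ?L)"
    by (rule is_sum_of_squares_P_form) (use conf in \<open>auto simp: configuration_def\<close>)
  ultimately have "is_sum_of_squares m n (\<lambda>x y. P_form ?K x y + P_form ?L x y) (r + num_squares ?L)"
    by (rule is_sum_of_squares_add)
  moreover have "P_form ?K x y + P_form ?L x y = P_form G x y" for x y
    using sum.subset_diff[of K1 "one_edges G" "\<lambda>c. (cell_monomial c x y)\<^sup>2"]
      sum.subset_diff[of K2 "two_edges G" "\<lambda>e. (\<Sum>c\<in>e. cell_monomial c x y)\<^sup>2"] fin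
    by (simp add: P_form_def)
  ultimately have "num_squares G \<le> r + num_squares ?L"
    using assms unfolding irreducible_config_iff[OF conf] by simp
  moreover have "card (one_edges G - K1) = card (one_edges G) - card K1"
      "card (two_edges G - K2) = card (two_edges G) - card K2"
    using fin by (auto intro!: card_Diff_subset)
  \<comment> \<open>These inequalities ensure that the natural-number subtractions above do not
    truncate.\<close>
  moreover have "card K1 \<le> card (one_edges G)" "card K2 \<le> card (two_edges G)"
    using fin by (auto intro!: card_mono)
  ultimately show "num_squares H \<le> r"
    unfolding num_squares_restrict by (simp add: num_squares_def)
qed

end

subsection \<open>Counting cells in degree-one rows\<close>

lemma card_one_edges_degree_one_rows:
  assumes "U \<subseteq> degree_one_rows m G"
  shows "card {c \<in> one_edges G. fst c \<in> U} = card U"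
proof -
  have "finite U"
    using assms by (rule finite_subset) (simp add: degree_one_rows_def)
  have deg: "card {j. (i, j) \<in> one_edges G} = 1" if "i \<in> U" for i
    using that assms by (auto simp: degree_one_rows_def)
  have "{c \<in> one_edges G. fst c \<in> U} = Sigma U (\<lambda>i. {j. (i, j) \<in> one_edges G})"
    by auto
  \<comment> \<open>Each slice is finite because its cardinality is 1, whereas infinite sets have
    cardinality 0.\<close>
  also have "card \<dots> = (\<Sum>i\<in>U. card {j. (i, j) \<in> one_edges G})"
    by (rule card_SigmaI) (use \<open>finite U\<close> deg in \<open>auto intro: card_ge_0_finite\<close>)
  finally show ?thesis
    using deg by simp
qed

text \<open>Each cell of the rows in \<open>U\<close> is a hole or, by simplicity, lies in exactly
  one support. A one-edge in these rows covers one cell; a two-edge meeting them covers one cell,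
  and a second one if it is inner. Inner two-edges are therefore counted in both of the last two
  terms.\<close>

lemma card_rows_eq:
  assumes "configuration m n G" "simple_config G" "U \<subseteq> {1..m}"
  shows "n * card U = holes n G U + card {c \<in> one_edges G. fst c \<in> U}
    + inner_two_edges G U + card {e \<in> two_edges G. \<exists>c\<in>e. fst c \<in> U}"
proof -
  let ?X = "U \<times> {1..n}"
  note fin = configuration_finite[OF assms(1)]
  have fin_U: "finite U"
    using assms(3) finite_subset by blast
  have in_X: "c \<in> ?X \<longleftrightarrow> fst c \<in> U" if "c \<in> grid m n" for c
    using that by (auto simp: grid_def)
  have two: "e \<subseteq> grid m n" "card e = 2" if "e \<in> two_edges G" for e
    using assms(1) that by (auto simp: configuration_def)
  have fin_S: "finite (supports G)"
    using fin by (auto simp: supports_def)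
  have "card ?X = card {c \<in> ?X. \<not> occupied G c} + card {c \<in> ?X. occupied G c}"
  proof -
    have "?X = {c \<in> ?X. \<not> occupied G c} \<union> {c \<in> ?X. occupied G c}"
      by blast
    also have "card \<dots> = card {c \<in> ?X. \<not> occupied G c} + card {c \<in> ?X. occupied G c}"
      by (rule card_Un_disjoint) (use fin_U in auto)
    finally show ?thesis .
  qed
  also have "{c \<in> ?X. occupied G c} = (\<Union>e\<in>supports G. e \<inter> ?X)"
    by (auto simp: occupied_def)
  also have "card \<dots> = (\<Sum>e\<in>supports G. card (e \<inter> ?X))"
    using assms(2) fin_S fin_U
    by (intro card_UN_disjoint) (auto simp: simple_config_def dest: disjointD)
  \<comment> \<open>The two families of supports are disjoint: singletons against two-element
    sets.\<close>
  also have "\<dots> = (\<Sum>e\<in>(\<lambda>c. {c}) ` one_edges G. card (e \<inter> ?X)) + (\<Sum>e\<in>two_edges G. card (e \<inter> ?X))"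
    unfolding supports_def by (rule sum.union_disjoint) (use fin two in force)+
  also have "(\<Sum>e\<in>(\<lambda>c. {c}) ` one_edges G. card (e \<inter> ?X)) = (\<Sum>c\<in>one_edges G. card ({c} \<inter> ?X))"
    by (subst sum.reindex) auto
  also have "\<dots> = (\<Sum>c\<in>one_edges G. if fst c \<in> U then 1 else 0)"
  proof (rule sum.cong)
    fix c assume "c \<in> one_edges G"
    with assms(1) have "c \<in> grid m n"
      by (auto simp: configuration_def)
    from in_X[OF this] show "card ({c} \<inter> ?X) = (if fst c \<in> U then 1 else 0)"
      by (simp add: Int_insert_left del: mem_Sigma_iff)
  qed simp
  also have "\<dots> = card {c \<in> one_edges G. fst c \<in> U}"
    using fin by (simp add: sum.If_cases Int_def)
  \<comment> \<open>The number of halves in the rows of \<open>U\<close>, which is 0, 1 or 2, splits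
    into an indicator for both halves and one for at least one half.\<close>
  also have "(\<Sum>e\<in>two_edges G. card (e \<inter> ?X))
      = (\<Sum>e\<in>two_edges G. (if \<forall>c\<in>e. fst c \<in> U then 1 else 0) + (if \<exists>c\<in>e. fst c \<in> U then 1 else 0))"
  proof (rule sum.cong)
    fix e assume e: "e \<in> two_edges G"
    then obtain c d where cd: "e = {c, d}" "c \<noteq> d"
      using two(2) by (meson card_2_iff)
    with two(1)[OF e] in_X have "c \<in> ?X \<longleftrightarrow> fst c \<in> U" "d \<in> ?X \<longleftrightarrow> fst d \<in> U"
      by blast+
    with cd show "card (e \<inter> ?X)
        = (if \<forall>c\<in>e. fst c \<in> U then 1 else 0) + (if \<exists>c\<in>e. fst c \<in> U then 1 else 0)"
      by (auto simp: Int_insert_left simp del: mem_Sigma_iff)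
  qed simp
  also have "\<dots> = inner_two_edges G U + card {e \<in> two_edges G. \<exists>c\<in>e. fst c \<in> U}"
    using fin by (simp add: sum.distrib sum.If_cases Int_def inner_two_edges_def)
  finally show ?thesis
    unfolding holes_def by (simp only: card_cartesian_product card_atLeastAtMost) (simp add: mult.commute)
qed

section \<open>Comparison with \<open>z2\<close> and deletion of the rows of
  \<open>U\<close>\<close>

lemma num_squares_le_z2:
  assumes "limited m n G" "irreducible_config m n G"
  shows "num_squares G \<le> z2 m n"
  unfolding z2_def
proof (rule Max_ge)
  \<comment> \<open>\<open>Max\<close> bounds the elements of a finite set only. Finiteness follows
    from this crude bound: one-edges are cells and two-edges are sets of cells.\<close>
  have "num_squares G \<le> card (grid m n) + card (Pow (grid m n))" if "limited m n G" for G
    unfolding num_squares_def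
    by (intro add_mono card_mono) (use that in \<open>auto simp: limited_def configuration_def\<close>)
  then have "{num_squares G | G. limited m n G \<and> irreducible_config m n G}
      \<subseteq> {..card (grid m n) + card (Pow (grid m n))}"
    by blast
  then show "finite {num_squares G | G. limited m n G \<and> irreducible_config m n G}"
    by (rule finite_subset) simp
qed (use assms in auto)

theorem mainTheorem10:
  fixes m n s R :: nat and G :: config and U :: "nat set"
  assumes "m \<ge> n choose 2"
    and "limited m n G"
    and "irreducible_config m n G"
    and "R = num_squares G"
    and "U \<subseteq> degree_one_rows m G"
    and "card U = s"
  shows "int R - int n * int s + int (holes n G U) + int (inner_two_edges G U)
           \<le> int (z2 (m - s) n)"
proof -
  have conf: "configuration m n G" and simple: "simple_config G"
    and C4: "C4_free (one_edges G)" and card_E1: "card (one_edges G) = zarankiewicz m n"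
    using assms(2) by (auto simp: limited_def)
  note fin = configuration_finite[OF conf]
  have U: "U \<subseteq> {1..m}"
    using assms(5) by (auto simp: degree_one_rows_def)
  then have fin_U: "finite U"
    using finite_subset by blast
  have s_le: "s \<le> m"
    using card_mono[OF _ U] assms(6) by simp
  have "card {1..m - s} = card ({1..m} - U)"
    using U fin_U assms(6) by (simp add: card_Diff_subset)
  then obtain f where f: "bij_betw f {1..m - s} ({1..m} - U)"
    using finite_same_card_bij[of "{1..m - s}" "{1..m} - U"] by auto
  interpret row_embedding m "m - s" n f "{1..m} - U" G
    by unfold_locales (use f conf in auto)
  have E1: "card (one_edges G) = card K1 + s"
  proof -
    have "one_edges G = K1 \<union> {c \<in> one_edges G. fst c \<in> U}"
      using conf by (fastforce simp: configuration_def grid_def)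
    also have "card \<dots> = card K1 + card {c \<in> one_edges G. fst c \<in> U}"
      by (rule card_Un_disjoint) (use fin in auto)
    finally show ?thesis
      using card_one_edges_degree_one_rows[OF assms(5)] assms(6) by simp
  qed
  have E2: "card (two_edges G) = card K2 + card {e \<in> two_edges G. \<exists>c\<in>e. fst c \<in> U}"
  proof -
    have "two_edges G = K2 \<union> {e \<in> two_edges G. \<exists>c\<in>e. fst c \<in> U}"
      using conf by (fastforce simp: configuration_def grid_def)
    also have "card \<dots> = card K2 + card {e \<in> two_edges G. \<exists>c\<in>e. fst c \<in> U}"
      by (rule card_Un_disjoint) (use fin in auto)
    finally show ?thesis .
  qed
  have "card (one_edges H) = zarankiewicz (m - s) n"
  \<comment> \<open>The extremal graph needs a column. For n = 0 there are no one-edges, so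
    \<open>E1\<close> forces s = 0 and no row is deleted.\<close>
  proof (cases "n = 0")
    case True
    then have "one_edges G = {}"
      using conf by (auto simp: configuration_def grid_def)
    then show ?thesis
      using E1 card_E1 bij_betw_same_card[OF bij_one_edges] by simp
  next
    case False
    then have "zarankiewicz m n \<ge> m + (n choose 2)"
      using assms(1) by (intro zarankiewicz_ge) auto
    \<comment> \<open>Each deleted row takes away exactly one one-edge. The resulting count reaches
      the general upper bound on the Zarankiewicz number for m - s rows, so
      \<open>one_edges H\<close> is extremal.\<close>
    then have "card (one_edges H) \<ge> (m - s) + (n choose 2)"
      using E1 card_E1 bij_betw_same_card[OF bij_one_edges] s_le by simp
    moreover have "card (one_edges H) \<le> zarankiewicz (m - s) n"
      using configuration_restrict C4_free_restrict[OF C4]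
      by (intro card_le_zarankiewicz) (auto simp: configuration_def)
    ultimately show ?thesis
      using zarankiewicz_le[of "m - s" n] by simp
  qed
  then have "limited (m - s) n H"
    using configuration_restrict simple_config_restrict[OF simple] C4_free_restrict[OF C4]
    by (simp add: limited_def)
  then have le: "num_squares H \<le> z2 (m - s) n"
    using irreducible_config_restrict[OF assms(3)] by (rule num_squares_le_z2)
  \<comment> \<open>With d two-edges meeting \<open>U\<close>, R is \<open>num_squares H\<close> + s
    + d, and the cell count says that n * s is the sum of s + d, the holes and the inner two-edges.
    Eliminating s + d gives the identity, stated additively to avoid truncated subtraction.\<close>
  have "R + holes n G U + inner_two_edges G U = num_squares H + n * s"
    using card_rows_eq[OF conf simple U] card_one_edges_degree_one_rows[OF assms(5)] E1 E2
      num_squares_restrict assms(4,6) by (simp add: num_squares_def)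
  then have "int R + int (holes n G U) + int (inner_two_edges G U) = int (num_squares H) + int n * int s"
    by (metis of_nat_add of_nat_mult)
  with le show ?thesis by simp
qed

end
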